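(* Let $\Gamma$ be a connected rectangular skew-graph, let $(i_0,j_0)$ be its source (the lower left node), and let $\mathbf e=(e_1,e_2)$ be the principal nilpotent pair in $\mathfrak g$ constructed from $\Gamma$, where $\mathfrak g=\mathfrak{so}(V)$ if $\Gamma$ is integral or non-integral, and $\mathfrak g=\mathfrak{sp}(V)$ if $\Gamma$ is semi-integral. Then the elements $e_1^ke_2^l$ with $k,l\in\{0,1,2,\dots\}$, $(i_0+k,j_0+l)\in n(\Gamma)$ and $k+l$ odd form a basis of $\mathfrak z_{\mathfrak g}(\mathbf e)$; in particular $$\mathfrak z_{\mathfrak g}(\mathbf e)=\langle e_1^ke_2^l \mid (i_0+k,j_0+l)\in n(\Gamma),\ k+l\ \text{is odd}\rangle .$$
   Context: $K$ is an algebraically closed field of characteristic $0$, $\mathfrak z_{\mathfrak g}(\mathbf e)$ is the centralizer of $\{e_1,e_2\}$ in $\mathfrak g$, $\langle\dots\rangle$ denotes linear span. A nilpotent pair in a semisimple Lie algebra $\mathfrak g$ with adjoint group $G$ is a pair of commuting elements $(e_1,e_2)$ such that for all $t_1,t_2\in K^*$ the pair $(t_1e_1,t_2e_2)$ is $G$-conjugate to $(e_1,e_2)$; it is principal if $\dim\mathfrak z_{\mathfrak g}(\mathbf e)=\operatorname{rk}\mathfrak g$. A rectangular skew-graph is an oriented graph whose node set is $n(\Gamma)=\{(i,j): i\in I,\ j\in J\}$, where $I=\{-a,-a+1,\dots,a\}$, $J=\{-b,-b+1,\dots,b\}$ with $a,b\in\frac12\mathbb Z_{\ge0}$, and whose arrows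 are all $(i,j)\to(i+1,j)$ and $(i,j)\to(i,j+1)$ between nodes. It is *integral* if $a,b\in\mathbb Z$, *non-integral* if $a,b\in\frac12+\mathbb Z$, *semi-integral* if $a+b\in\frac12+\mathbb Z$. Let $V$ be a $K$-vector space with basis $v_{i,j}$, $(i,j)\in n(\Gamma)$, and put $v_{i,j}=0$ for $(i,j)\notin n(\Gamma)$. *Integral and non-integral case:* $V$ carries the symmetric form with $(v_{i,j},v_{-k,-l})=\delta_{ik}\delta_{jl}$, and $e_1(v_{i,j})=(-1)^{i+j}v_{i+1,j}$, $e_2(v_{i,j})=(-1)^{i+j+1}v_{i,j+1}$. *Semi-integral case with $i\in\mathbb Z$, $j\in\frac12+\mathbb Z$:* $V$ carries the alternating form with $(v_{i,j},v_{-k,-l})=0$ unless $(i,j)=(k,l)$ and $(v_{i,j},v_{-i,-j})=1$ for $j>0$; $e_1(v_{i,j})=-v_{i+1,j}$ if $j>0$, $e_1(v_{i,j})=v_{i+1,j}$ if $j<0$; $e_2(v_{i,j})=v_{i,j+1}$ if $j>0$, $e_2(v_{i,j})=(-1)^iv_{i,j+1}$ if $j=-\frac12$, $e_2(v_{i,j})=-v_{i,j+1}$ if $j+1<0$. *Semi-integral case with $j\in\mathbb Z$, $i\in\frac12+\mathbb Z$:* $V$ carries the alternating form with $(v_{i,j},v_{-k,-l})=0$ unless $(i,j)=(k,l)$ and $(v_{i,j},v_{-i,-j})=1$ for $i>0$; $e_2(v_{i,j})=-v_{i,j+1}$ if $i>0$, $e_2(v_{i,j})=v_{i,j+1}$ if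 $i<0$; $e_1(v_{i,j})=v_{i+1,j}$ if $i>0$, $e_1(v_{i,j})=(-1)^jv_{i+1,j}$ if $i=-\frac12$, $e_1(v_{i,j})=-v_{i+1,j}$ if $i+1<0$. *)

theory Defs
  imports
    "HOL-Library.Function_Algebras"
    "HOL-Computational_Algebra.Polynomial"
    "Graph_Theory.Graph_Theory"
begin

section \<open>Rectangular skew-graphs\<close>

text \<open>Nodes are pairs of rationals; \<open>half_range a\<close> is the index set \<open>{-a, -a + 1, \<dots>, a}\<close>.\<close>

definition half_range :: "rat \<Rightarrow> rat set" where
  "half_range a = {i. \<exists>m::nat. i = - a + of_nat m \<and> i \<le> a}"

definition rect_skew_graph :: "rat \<Rightarrow> rat \<Rightarrow> (rat \<times> rat) pair_pre_digraph" where
  "rect_skew_graph a b = \<lparr>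
     pverts = half_range a \<times> half_range b,
     parcs = {(p, q). p \<in> half_range a \<times> half_range b \<and> q \<in> half_range a \<times> half_range b \<and>
                (q = (fst p + 1, snd p) \<or> q = (fst p, snd p + 1))} \<rparr>"

definition half_natural :: "rat \<Rightarrow> bool" where
  "half_natural a \<longleftrightarrow> 2 * a \<in> \<nat>"

definition half_odd :: "rat \<Rightarrow> bool" where
  "half_odd a \<longleftrightarrow> a - 1 / 2 \<in> \<int>"

definition integral_graph :: "rat \<Rightarrow> rat \<Rightarrow> bool" where
  "integral_graph a b \<longleftrightarrow> a \<in> \<int> \<and> b \<in> \<int>"

definition non_integral_graph :: "rat \<Rightarrow> rat \<Rightarrow> bool" where
  "non_integral_graph a b \<longleftrightarrow> half_odd a \<and> half_odd b"

definition semi_integral_graph :: "rat \<Rightarrow> rat \<Rightarrow> bool" where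
  "semi_integral_graph a b \<longleftrightarrow> half_odd (a + b)"

definition is_source :: "'a pair_pre_digraph \<Rightarrow> 'a \<Rightarrow> bool" where
  "is_source \<Gamma> p \<longleftrightarrow> p \<in> pverts \<Gamma> \<and> in_arcs \<Gamma> p = {}"

section \<open>Linear algebra over an abstract vector space\<close>

definition basis_family ::
  "('k::field \<Rightarrow> 'w::ab_group_add \<Rightarrow> 'w) \<Rightarrow> ('i \<Rightarrow> 'w) \<Rightarrow> 'i set \<Rightarrow> 'w set \<Rightarrow> bool" where
  "basis_family s f N W \<longleftrightarrow>
     inj_on f N \<and> \<not> module.dependent s (f ` N) \<and> module.span s (f ` N) = W"

definition end_scale :: "('k \<Rightarrow> 'v \<Rightarrow> 'v) \<Rightarrow> 'k \<Rightarrow> ('v \<Rightarrow> 'v) \<Rightarrow> ('v \<Rightarrow> 'v)" where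
  "end_scale s c f = (\<lambda>u. s c (f u))"

lemma vector_space_end_scale:
  assumes "vector_space s"
  shows "vector_space (end_scale s)"
proof -
  interpret vector_space s by fact
  show ?thesis
    by unfold_locales
      (auto simp: end_scale_def fun_eq_iff scale_right_distrib scale_left_distrib)
qed

definition bilinear_form ::
  "('k::field \<Rightarrow> 'v::ab_group_add \<Rightarrow> 'v) \<Rightarrow> ('v \<Rightarrow> 'v \<Rightarrow> 'k) \<Rightarrow> bool" where
  "bilinear_form s B \<longleftrightarrow>
     (\<forall>w. Vector_Spaces.linear s (*) (\<lambda>u. B u w)) \<and> (\<forall>u. Vector_Spaces.linear s (*) (\<lambda>w. B u w))"

definition symmetric_form :: "('v \<Rightarrow> 'v \<Rightarrow> 'k) \<Rightarrow> bool" where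
  "symmetric_form B \<longleftrightarrow> (\<forall>u w. B u w = B w u)"

definition alternating_form :: "('v \<Rightarrow> 'v \<Rightarrow> 'k::zero) \<Rightarrow> bool" where
  "alternating_form B \<longleftrightarrow> (\<forall>u. B u u = 0)"

section \<open>Orthogonal and symplectic Lie algebras, centralizers\<close>

text \<open>The skewness condition is the same for \<open>so_alg\<close> and \<open>sp_alg\<close>; what distinguishes them is that
  the form \<open>B\<close> is nondegenerate symmetric, respectively nondegenerate alternating.\<close>

definition so_alg ::
  "('k::field \<Rightarrow> 'v::ab_group_add \<Rightarrow> 'v) \<Rightarrow> ('v \<Rightarrow> 'v \<Rightarrow> 'k) \<Rightarrow> ('v \<Rightarrow> 'v) set" where
  "so_alg s B = {x. Vector_Spaces.linear s s x \<and> (\<forall>u w. B (x u) w + B u (x w) = 0)}"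

definition sp_alg ::
  "('k::field \<Rightarrow> 'v::ab_group_add \<Rightarrow> 'v) \<Rightarrow> ('v \<Rightarrow> 'v \<Rightarrow> 'k) \<Rightarrow> ('v \<Rightarrow> 'v) set" where
  "sp_alg s B = {x. Vector_Spaces.linear s s x \<and> (\<forall>u w. B (x u) w + B u (x w) = 0)}"

definition lie_bracket :: "('v::ab_group_add \<Rightarrow> 'v) \<Rightarrow> ('v \<Rightarrow> 'v) \<Rightarrow> ('v \<Rightarrow> 'v)" where
  "lie_bracket x y = (x \<circ> y) - (y \<circ> x)"

lemma lie_bracket_apply: "lie_bracket x y u = x (y u) - y (x u)"
  by (simp add: lie_bracket_def)

definition lie_centralizer :: "('v::ab_group_add \<Rightarrow> 'v) set \<Rightarrow> ('v \<Rightarrow> 'v) set \<Rightarrow> ('v \<Rightarrow> 'v) set" where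
  "lie_centralizer \<gg> S = {x \<in> \<gg>. \<forall>y\<in>S. lie_bracket x y = 0}"

section \<open>The pair attached to a rectangular skew-graph\<close>

text \<open>The floors below are only applied to rationals that are integers.  The factor \<open>v\<close> vanishes
  off the nodes, so the formulas for \<open>e1\<close>, \<open>e2\<close> also cover the last column and row.\<close>

locale skew_graph_pair = vector_space scale
  for scale :: "'k::{alg_closed_field, field_char_0} \<Rightarrow> 'v::ab_group_add \<Rightarrow> 'v" +
  fixes a b :: rat
    and v :: "rat \<times> rat \<Rightarrow> 'v"
    and B :: "'v \<Rightarrow> 'v \<Rightarrow> 'k"
    and e1 e2 :: "'v \<Rightarrow> 'v"
  assumes v_basis: "basis_family scale v (pverts (rect_skew_graph a b)) UNIV"
    and v_outside: "p \<notin> pverts (rect_skew_graph a b) \<Longrightarrow> v p = 0"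
    and bilinear_B: "bilinear_form scale B"
    and linear_e1: "Vector_Spaces.linear scale scale e1"
    and linear_e2: "Vector_Spaces.linear scale scale e2"
    and integral_or_non_integral_form:
      "integral_graph a b \<or> non_integral_graph a b \<Longrightarrow>
         symmetric_form B \<and>
         (\<forall>(i, j) \<in> pverts (rect_skew_graph a b). \<forall>(k, l) \<in> pverts (rect_skew_graph a b).
            B (v (i, j)) (v (- k, - l)) = (if i = k \<and> j = l then 1 else 0))"
    and integral_or_non_integral_action:
      "integral_graph a b \<or> non_integral_graph a b \<Longrightarrow>
         (\<forall>(i, j) \<in> pverts (rect_skew_graph a b).
            e1 (v (i, j)) = scale ((- 1) powi \<lfloor>i + j\<rfloor>) (v (i + 1, j)) \<and>
            e2 (v (i, j)) = scale ((- 1) powi \<lfloor>i + j + 1\<rfloor>) (v (i, j + 1)))"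
    and semi_integral_form_1:
      "semi_integral_graph a b \<and> a \<in> \<int> \<and> half_odd b \<Longrightarrow>
         alternating_form B \<and>
         (\<forall>(i, j) \<in> pverts (rect_skew_graph a b). \<forall>(k, l) \<in> pverts (rect_skew_graph a b).
            (i, j) \<noteq> (k, l) \<longrightarrow> B (v (i, j)) (v (- k, - l)) = 0) \<and>
         (\<forall>(i, j) \<in> pverts (rect_skew_graph a b). j > 0 \<longrightarrow> B (v (i, j)) (v (- i, - j)) = 1)"
    and semi_integral_action_1:
      "semi_integral_graph a b \<and> a \<in> \<int> \<and> half_odd b \<Longrightarrow>
         (\<forall>(i, j) \<in> pverts (rect_skew_graph a b).
            (j > 0 \<longrightarrow> e1 (v (i, j)) = - v (i + 1, j)) \<and>
            (j < 0 \<longrightarrow> e1 (v (i, j)) = v (i + 1, j)) \<and>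
            (j > 0 \<longrightarrow> e2 (v (i, j)) = v (i, j + 1)) \<and>
            (j = - 1 / 2 \<longrightarrow> e2 (v (i, j)) = scale ((- 1) powi \<lfloor>i\<rfloor>) (v (i, j + 1))) \<and>
            (j + 1 < 0 \<longrightarrow> e2 (v (i, j)) = - v (i, j + 1)))"
    and semi_integral_form_2:
      "semi_integral_graph a b \<and> b \<in> \<int> \<and> half_odd a \<Longrightarrow>
         alternating_form B \<and>
         (\<forall>(i, j) \<in> pverts (rect_skew_graph a b). \<forall>(k, l) \<in> pverts (rect_skew_graph a b).
            (i, j) \<noteq> (k, l) \<longrightarrow> B (v (i, j)) (v (- k, - l)) = 0) \<and>
         (\<forall>(i, j) \<in> pverts (rect_skew_graph a b). i > 0 \<longrightarrow> B (v (i, j)) (v (- i, - j)) = 1)"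
    and semi_integral_action_2:
      "semi_integral_graph a b \<and> b \<in> \<int> \<and> half_odd a \<Longrightarrow>
         (\<forall>(i, j) \<in> pverts (rect_skew_graph a b).
            (i > 0 \<longrightarrow> e2 (v (i, j)) = - v (i, j + 1)) \<and>
            (i < 0 \<longrightarrow> e2 (v (i, j)) = v (i, j + 1)) \<and>
            (i > 0 \<longrightarrow> e1 (v (i, j)) = v (i + 1, j)) \<and>
            (i = - 1 / 2 \<longrightarrow> e1 (v (i, j)) = scale ((- 1) powi \<lfloor>j\<rfloor>) (v (i + 1, j))) \<and>
            (i + 1 < 0 \<longrightarrow> e1 (v (i, j)) = - v (i + 1, j)))"

end

theory Submission
  imports Defs
begin

text \<open>The pair commutes and the source vector is cyclic: its images under the monomials
  \<open>e1\<^sup>k e2\<^sup>l\<close> are nonzero multiples of the basis vectors.  Evaluation there is injective on the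
  centralizer in \<open>End V\<close>, which therefore consists of the polynomials in \<open>e1\<close>, \<open>e2\<close>.  The monomial
  \<open>e1\<^sup>k e2\<^sup>l\<close> has adjoint \<open>(- 1)\<close> to the power \<open>k + l\<close> times itself, so the even part of a skew
  polynomial is both skew and selfadjoint, hence zero.\<close>

section \<open>Finite bases and bilinear forms\<close>

text \<open>The obstacle is the signs: there are three sign conventions, two of them changing where
  a half-odd coordinate crosses 0. The locale \<open>signed_rectangle\<close> isolates what the
  argument asks of them. Nonzero coefficients make the source cyclic; an equation around each unit
  square gives commutativity; an equation between each arrow and its image under p -> -p gives
  skewness; nonzero values \<open>t\<close> give nondegeneracy. Whether \<open>B\<close> is
  symmetric or alternating shows only in how \<open>t\<close> behaves under p -> -p, so one argument
  serves both the orthogonal and the symplectic case.\<close>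

lemma sum_fun_apply: "(\<Sum>p\<in>N. f p) u = (\<Sum>p\<in>N. f p u)"
  by (induction N rule: infinite_finite_induct) auto

text \<open>Replaces \<open>dependent\<close> and \<open>span\<close>, which speak of sets of
  vectors, by coefficients on the index set. Injectivity is absorbed into independence: if f p = f q
  with p and q distinct, the coefficients 1 and -1 give a nontrivial relation.\<close>

lemma (in vector_space) basis_family_finite_iff:
  assumes "finite N"
  shows "basis_family scale f N W \<longleftrightarrow>
    (\<forall>c. (\<Sum>p\<in>N. scale (c p) (f p)) = 0 \<longrightarrow> (\<forall>p\<in>N. c p = 0)) \<and>
    W = range (\<lambda>c. \<Sum>p\<in>N. scale (c p) (f p))"
    (is "_ \<longleftrightarrow> ?I \<and> W = ?R")
proof -
  have inj: "inj_on f N" if I: ?I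
  proof (rule inj_onI, rule ccontr)
    fix p q assume pq: "p \<in> N" "q \<in> N" "f p = f q" "p \<noteq> q"
    define c :: "_ \<Rightarrow> 'a" where "c = (\<lambda>r. if r = p then 1 else if r = q then - 1 else 0)"
    have "(\<Sum>r\<in>N. scale (c r) (f r))
        = (\<Sum>r\<in>N. (if r = p then f p else 0) + (if r = q then - f q else 0))"
      using pq by (intro sum.cong) (auto simp: c_def)
    also have "\<dots> = 0"
      using pq assms by (simp add: sum.distrib)
    finally have "c p = 0"
      using I pq(1) by blast
    then show False by (simp add: c_def)
  qed
  have reindex: "(\<Sum>x\<in>f ` N. scale (g x) x) = (\<Sum>p\<in>N. scale (g (f p)) (f p))"
    if "inj_on f N" for g
    using that by (simp add: sum.reindex)
  have indep: "\<not> dependent (f ` N) \<longleftrightarrow> ?I" if "inj_on f N"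
  proof -
    have "(\<exists>g. (\<exists>x\<in>f ` N. g x \<noteq> 0) \<and> (\<Sum>x\<in>f ` N. scale (g x) x) = 0) \<longleftrightarrow> \<not> ?I"
    proof (intro iffI notI)
      assume I: ?I and "\<exists>g. (\<exists>x\<in>f ` N. g x \<noteq> 0) \<and> (\<Sum>x\<in>f ` N. scale (g x) x) = 0"
      then obtain g p where "p \<in> N" "g (f p) \<noteq> 0" "(\<Sum>x\<in>f ` N. scale (g x) x) = 0"
        by blast
      then show False
        unfolding reindex[OF that] using I[rule_format, of "\<lambda>p. g (f p)" p] by simp
    next
      assume "\<not> ?I"
      then obtain c p where c: "(\<Sum>p\<in>N. scale (c p) (f p)) = 0" "p \<in> N" "c p \<noteq> 0"
        by blast
      then show "\<exists>g. (\<exists>x\<in>f ` N. g x \<noteq> 0) \<and> (\<Sum>x\<in>f ` N. scale (g x) x) = 0"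
        \<comment> \<open>\<open>inv_into\<close> carries coefficients on indices over to
          coefficients on vectors.\<close>
        using that by (intro exI[of _ "c \<circ> inv_into N f"]) (auto simp: reindex)
    qed
    then show ?thesis
      using assms by (simp add: dependent_finite)
  qed
  have span: "span (f ` N) = ?R" if "inj_on f N"
  proof -
    have "(\<Sum>p\<in>N. scale (c p) (f p)) \<in> range (\<lambda>g. \<Sum>x\<in>f ` N. scale (g x) x)" for c
      using that
      by (intro image_eqI[where x = "c \<circ> inv_into N f"]) (auto simp: reindex intro!: sum.cong)
    then show ?thesis
      using that assms by (auto simp: span_finite reindex)
  qed
  show ?thesis
    unfolding basis_family_def using inj indep span by blast
qed

lemma (in vector_space) basis_family_expansion:
  assumes "finite N" "basis_family scale f N W" "u \<in> W"
  obtains c where "u = (\<Sum>p\<in>N. scale (c p) (f p))"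
  using assms by (auto simp: basis_family_finite_iff)

lemma (in vector_space) basis_family_coeff_zero:
  assumes "finite N" "basis_family scale f N W" "(\<Sum>p\<in>N. scale (c p) (f p)) = 0" "p \<in> N"
  shows "c p = 0"
  using assms by (auto simp: basis_family_finite_iff)

lemma bilinear_form_iff:
  assumes "vector_space s"
  shows "bilinear_form s B \<longleftrightarrow>
    (\<forall>u u' w. B (u + u') w = B u w + B u' w) \<and> (\<forall>c u w. B (s c u) w = c * B u w) \<and>
    (\<forall>u w w'. B u (w + w') = B u w + B u w') \<and> (\<forall>c u w. B u (s c w) = c * B u w)"
proof -
  \<comment> \<open>The target of the linear maps in \<open>bilinear_form\<close> is the field over
    itself, and \<open>Vector_Spaces.linear_iff\<close> asks for vector spaces on both
    sides.\<close>
  have "vector_space ((*) :: 'a \<Rightarrow> 'a \<Rightarrow> 'a)"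
    by unfold_locales (auto simp: algebra_simps)
  then show ?thesis
    using assms by (auto simp: bilinear_form_def Vector_Spaces.linear_iff)
qed

lemma bilinear_form_sum:
  assumes "vector_space s" "bilinear_form s B"
  shows "B (\<Sum>p\<in>N. s (c p) (f p)) w = (\<Sum>p\<in>N. c p * B (f p) w)"
    and "B u (\<Sum>p\<in>N. s (c p) (f p)) = (\<Sum>p\<in>N. c p * B u (f p))"
proof -
  interpret vector_space s by fact
  note lin = assms(2)[unfolded bilinear_form_iff[OF assms(1)]]
  have "B 0 w = 0" "B u 0 = 0"
    using lin by (metis mult_zero_left scale_zero_left)+
  then show "B (\<Sum>p\<in>N. s (c p) (f p)) w = (\<Sum>p\<in>N. c p * B (f p) w)"
    and "B u (\<Sum>p\<in>N. s (c p) (f p)) = (\<Sum>p\<in>N. c p * B u (f p))"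
    using lin by (induction N rule: infinite_finite_induct) auto
qed

section \<open>Commuting skew pairs with a cyclic vector\<close>

text \<open>Uncurried, so that it is a family for \<open>basis_family\<close> and unfolds to the
  lambda term of the theorem.\<close>

definition pair_monomial :: "('v \<Rightarrow> 'v) \<Rightarrow> ('v \<Rightarrow> 'v) \<Rightarrow> nat \<times> nat \<Rightarrow> 'v \<Rightarrow> 'v" where
  "pair_monomial e1 e2 = (\<lambda>(k, l). (e1 ^^ k) \<circ> (e2 ^^ l))"

lemma commute_funpow:
  fixes x f :: "'x \<Rightarrow> 'x"
  assumes "\<And>u. x (f u) = f (x u)"
  shows "x ((f ^^ n) u) = (f ^^ n) (x u)"
  by (induction n) (auto simp: assms)

lemma commute_monomial:
  assumes "\<And>u. x (e1 u) = e1 (x u)" "\<And>u. x (e2 u) = e2 (x u)"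
  shows "x (pair_monomial e1 e2 p u) = pair_monomial e1 e2 p (x u)"
  by (auto simp: pair_monomial_def commute_funpow[of x e1, OF assms(1)]
      commute_funpow[of x e2, OF assms(2)]
      split: prod.split)

lemma adjoint_funpow:
  assumes "\<And>u w. B (f u) w = - B u (f w)"
  shows "B ((f ^^ n) u) w = (- 1) ^ n * (B u ((f ^^ n) w) :: 'x::comm_ring_1)"
proof (induction n arbitrary: w)
  case (Suc n)
  have "B ((f ^^ Suc n) u) w = (- 1) ^ Suc n * B u ((f ^^ n) (f w))"
    by (simp add: assms Suc)
  then show ?case by (simp add: funpow_swap1)
qed simp

text \<open>Each factor moved across \<open>B\<close> costs a sign. The move reverses the order of
  the two powers, and commutativity restores it.\<close>

lemma adjoint_monomial:
  assumes "\<And>u. e1 (e2 u) = e2 (e1 u)"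
    and "\<And>u w. B (e1 u) w = - B u (e1 w)" "\<And>u w. B (e2 u) w = - B u (e2 w)"
  shows "B (pair_monomial e1 e2 (k, l) u) w =
    (- 1) ^ (k + l) * (B u (pair_monomial e1 e2 (k, l) w) :: 'x::comm_ring_1)"
proof -
  have "(e1 ^^ k) ((e2 ^^ l) w) = (e2 ^^ l) ((e1 ^^ k) w)"
    by (intro commute_funpow commute_funpow[symmetric]) (simp add: assms)
  then show ?thesis
    using adjoint_funpow[of B e1 k, OF assms(2)] adjoint_funpow[of B e2 l, OF assms(3)]
    by (simp add: pair_monomial_def power_add mult.assoc)
qed

context vector_space
begin

lemma linear_funpow: "Vector_Spaces.linear scale scale f \<Longrightarrow> Vector_Spaces.linear scale scale (f ^^ n)"
  by (induction n) (auto simp: Vector_Spaces.linear_iff)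

lemma linear_monomial:
  "Vector_Spaces.linear scale scale e1 \<Longrightarrow> Vector_Spaces.linear scale scale e2 \<Longrightarrow>
    Vector_Spaces.linear scale scale (pair_monomial e1 e2 p)"
  using linear_funpow[of e1] linear_funpow[of e2]
  by (auto simp: pair_monomial_def Vector_Spaces.linear_iff split: prod.split)

lemma linear_combination:
  assumes "\<And>p. p \<in> N \<Longrightarrow> Vector_Spaces.linear scale scale (f p)"
  shows "Vector_Spaces.linear scale scale (\<Sum>p\<in>N. end_scale scale (c p) (f p))"
  using assms vector_space_axioms unfolding Vector_Spaces.linear_iff
  by (auto simp: sum_fun_apply end_scale_def scale_right_distrib sum.distrib scale_sum_right
      scale_left_commute intro!: sum.cong)

lemma linear_sum_scale:
  assumes "Vector_Spaces.linear scale scale f"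
  shows "f (\<Sum>p\<in>N. scale (c p) (g p)) = (\<Sum>p\<in>N. scale (c p) (f (g p)))"
proof -
  interpret f: Vector_Spaces.linear scale scale f by fact
  show ?thesis by (simp add: f.sum f.scale)
qed

lemma basis_centralizer_cyclic:
  assumes "finite N" and basis: "basis_family scale (\<lambda>p. pair_monomial e1 e2 p cyc) N UNIV"
    and lin: "Vector_Spaces.linear scale scale e1" "Vector_Spaces.linear scale scale e2"
    and comm: "\<And>u. e1 (e2 u) = e2 (e1 u)"
    and bil: "bilinear_form scale B"
    and skew: "\<And>u w. B (e1 u) w = - B u (e1 w)" "\<And>u w. B (e2 u) w = - B u (e2 w)"
    and nondeg: "\<forall>u. (\<forall>w. B u w = 0) \<longrightarrow> u = 0"
    and char: "(2::'a) \<noteq> 0"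
  shows "basis_family (end_scale scale) (pair_monomial e1 e2) {(k, l). (k, l) \<in> N \<and> odd (k + l)}
           (lie_centralizer (so_alg scale B) {e1, e2})"
proof -
  let ?E = "pair_monomial e1 e2"
  let ?comb = "\<lambda>N c. \<Sum>p\<in>N. end_scale scale (c p) (?E p)"
  define F where "F = {(k, l). (k, l) \<in> N \<and> odd (k + l)}"
  have "F \<subseteq> N" and finF: "finite F"
    using \<open>finite N\<close> by (auto simp: F_def intro: finite_subset[of _ N])
  \<comment> \<open>The monomials live in the space of all functions on V with pointwise
    operations.\<close>
  interpret E: vector_space "end_scale scale"
    by (intro vector_space_end_scale vector_space_axioms)
  have comb_apply: "?comb M c u = (\<Sum>p\<in>M. scale (c p) (?E p u))" for M c u
    by (simp add: sum_fun_apply end_scale_def)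
  have linE: "Vector_Spaces.linear scale scale (?E p)" for p
    using lin by (rule linear_monomial)
  have lin_comb: "Vector_Spaces.linear scale scale (?comb M c)" for M c
    by (intro linear_combination linE)
  have EE: "?E p (?E q u) = ?E q (?E p u)" for p q u
    by (intro commute_monomial commute_monomial[symmetric]) (simp_all add: comm)
  have e1E: "e1 (?E p u) = ?E p (e1 u)" and e2E: "e2 (?E p u) = ?E p (e2 u)" for p u
    by (intro commute_monomial; simp add: comm)+
  have adj: "B (?comb M c u) w = (\<Sum>p\<in>M. (- 1) ^ (fst p + snd p) * (c p * B u (?E p w)))" for M c u w
    unfolding comb_apply bilinear_form_sum[OF vector_space_axioms bil]
    using adjoint_monomial[of e1 e2 B, OF comm skew] by (auto intro!: sum.cong)
  have odd_adj: "B (?comb F c u) w = - B u (?comb F c w)" for c u w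
    unfolding adj unfolding comb_apply bilinear_form_sum[OF vector_space_axioms bil]
    by (auto simp: F_def sum_negf[symmetric] intro!: sum.cong)
  have even_adj: "B (?comb (N - F) c u) w = B u (?comb (N - F) c w)" for c u w
    unfolding adj unfolding comb_apply bilinear_form_sum[OF vector_space_axioms bil]
    by (auto simp: F_def minus_one_power_iff intro!: sum.cong split: if_splits)
  have comb_in: "?comb F c \<in> lie_centralizer (so_alg scale B) {e1, e2}" for c
    using lin_comb[of c F] odd_adj[of c]
    by (auto simp: lie_centralizer_def so_alg_def fun_eq_iff lie_bracket_apply comb_apply
        linear_sum_scale[OF lin(1)] linear_sum_scale[OF lin(2)] e1E e2E)
  have in_comb: "x \<in> range (?comb F)" if "x \<in> lie_centralizer (so_alg scale B) {e1, e2}" for x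
  proof -
    have linx: "Vector_Spaces.linear scale scale x" and skewx: "B (x u) w + B u (x w) = 0"
      and xe: "x (e1 u) = e1 (x u)" "x (e2 u) = e2 (x u)" for u w
      using that by (auto simp: lie_centralizer_def so_alg_def fun_eq_iff lie_bracket_apply)
    \<comment> \<open>The coordinates of \<open>x cyc\<close> are the coefficients of the only
      polynomial that can equal x.\<close>
    obtain c where c: "x cyc = (\<Sum>p\<in>N. scale (c p) (?E p cyc))"
      by (rule basis_family_expansion[OF \<open>finite N\<close> basis UNIV_I])
    have x: "x = ?comb N c"
    proof
      fix u
      obtain d where u: "u = (\<Sum>p\<in>N. scale (d p) (?E p cyc))"
        by (rule basis_family_expansion[OF \<open>finite N\<close> basis UNIV_I])
      \<comment> \<open>Both sides commute with \<open>?E q\<close>, so agreement at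
        \<open>cyc\<close> spreads to the whole basis.\<close>
      have "x (?E q cyc) = ?comb N c (?E q cyc)" for q
        by (simp add: commute_monomial[of x e1 e2, OF xe] c comb_apply linear_sum_scale[OF linE] EE[of q])
      then show "x u = ?comb N c u"
        unfolding u linear_sum_scale[OF linx] linear_sum_scale[OF lin_comb] by simp
    qed
    have split: "x u = ?comb F c u + ?comb (N - F) c u" for u
      using sum.subset_diff[OF \<open>F \<subseteq> N\<close> \<open>finite N\<close>, of "\<lambda>p. end_scale scale (c p) (?E p)"]
      by (simp add: x add.commute)
    have "?comb (N - F) c u = 0" for u
    proof (rule nondeg[rule_format])
      fix w
      \<comment> \<open>The odd part cancels by its own skewness, while the selfadjoint even part
        counts twice.\<close>
      have "B (x u) w + B u (x w) = 2 * B (?comb (N - F) c u) w"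
        using bil[unfolded bilinear_form_iff[OF vector_space_axioms]]
        unfolding split by (simp only: odd_adj even_adj) simp
      with skewx char show "B (?comb (N - F) c u) w = 0"
        by simp
    qed
    then have "x = ?comb F c"
      by (simp add: fun_eq_iff split)
    then show ?thesis by blast
  qed
  have indep: "\<forall>p\<in>F. c p = 0" if "?comb F c = 0" for c
  proof -
    \<comment> \<open>A relation among odd monomials, evaluated at \<open>cyc\<close> and padded by
      zeros, is a relation among the basis vectors.\<close>
    have "(\<Sum>p\<in>N. scale (if p \<in> F then c p else 0) (?E p cyc)) = ?comb F c cyc"
      unfolding comb_apply using \<open>finite N\<close> \<open>F \<subseteq> N\<close>
      by (intro sum.mono_neutral_cong_right) auto
    then have zero: "(if p \<in> F then c p else 0) = 0" if "p \<in> N" for p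
      using basis_family_coeff_zero[OF \<open>finite N\<close> basis, of "\<lambda>p. if p \<in> F then c p else 0"] that
        \<open>?comb F c = 0\<close> by simp
    show ?thesis
      using zero \<open>F \<subseteq> N\<close> by (metis subsetD)
  qed
  show ?thesis
    unfolding F_def[symmetric] E.basis_family_finite_iff[OF finF]
    using indep comb_in in_comb by blast
qed

end

section \<open>Rectangles\<close>

text \<open>Counting from the left end makes positions natural numbers up to 2a, which are also the
  exponents of the monomials.\<close>

lemma half_range_eq_image:
  assumes "2 * a = of_nat m"
  shows "half_range a = (\<lambda>k. - a + of_nat k) ` {..m}"
proof -
  have "- a + of_nat k \<le> a \<longleftrightarrow> k \<le> m" for k
  proof -
    have "- a + of_nat k \<le> a \<longleftrightarrow> (of_nat k :: rat) \<le> of_nat m"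
      unfolding assms[symmetric] by auto
    then show ?thesis by simp
  qed
  then show ?thesis
    by (auto simp: half_range_def)
qed

lemma half_range_uminus:
  assumes "half_natural a" "i \<in> half_range a"
  shows "- i \<in> half_range a"
proof -
  obtain m where m: "2 * a = of_nat m"
    using assms(1) by (auto simp: half_natural_def elim: Nats_cases)
  then obtain k where "k \<le> m" "i = - a + of_nat k"
    using assms(2) by (auto simp: half_range_eq_image)
  \<comment> \<open>Reflection reverses the count: position k goes to 2a - k.\<close>
  then have "- i = - a + of_nat (m - k)"
    using m by (simp add: of_nat_diff)
  then show ?thesis
    by (auto simp: half_range_eq_image[OF m])
qed

text \<open>A positive offset from the corner provides a left or lower neighbour, hence an incoming
  arrow.\<close>

lemma source_rect_skew_graph:
  assumes "half_natural a" "half_natural b" "is_source (rect_skew_graph a b) (i, j)"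
  shows "i = - a \<and> j = - b"
proof -
  obtain m n where m: "2 * a = of_nat m" and n: "2 * b = of_nat n"
    using assms(1,2) by (auto simp: half_natural_def elim!: Nats_cases)
  note H = half_range_eq_image[OF m] half_range_eq_image[OF n]
  obtain k l where k: "k \<le> m" "i = - a + of_nat k" and l: "l \<le> n" "j = - b + of_nat l"
    using assms(3) by (auto simp: is_source_def rect_skew_graph_def H)
  have no_arc: "(p, i, j) \<notin> parcs (rect_skew_graph a b)" for p
    using assms(3) by (cases p) (auto simp: is_source_def in_arcs_def)
  have "k = 0"
  proof (cases k)
    case (Suc k')
    then have "((i - 1, j), i, j) \<in> parcs (rect_skew_graph a b)"
      using k l by (auto simp: rect_skew_graph_def H intro!: image_eqI[of _ _ k'] image_eqI[of _ _ k])
    with no_arc show ?thesis by blast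
  qed
  moreover have "l = 0"
  proof (cases l)
    case (Suc l')
    then have "((i, j - 1), i, j) \<in> parcs (rect_skew_graph a b)"
      using k l by (auto simp: rect_skew_graph_def H intro!: image_eqI[of _ _ l'] image_eqI[of _ _ l])
    with no_arc show ?thesis by blast
  qed
  ultimately show ?thesis
    using k l by simp
qed

text \<open>All cases of the construction have this shape; \<open>s1\<close>, \<open>s2\<close> are the coefficients of the two
  actions and \<open>t p\<close> is the value of the form on \<open>v p\<close>, \<open>v (- p)\<close>.\<close>

locale signed_rectangle = vector_space scale
  for scale :: "'k::field \<Rightarrow> 'v::ab_group_add \<Rightarrow> 'v" +
  fixes a b :: rat
    and v :: "rat \<times> rat \<Rightarrow> 'v"
    and B :: "'v \<Rightarrow> 'v \<Rightarrow> 'k"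
    and e1 e2 :: "'v \<Rightarrow> 'v"
    and s1 s2 t :: "rat \<times> rat \<Rightarrow> 'k"
  assumes a: "half_natural a" and b: "half_natural b"
    and basis: "basis_family scale v (half_range a \<times> half_range b) UNIV"
    and outside: "p \<notin> half_range a \<times> half_range b \<Longrightarrow> v p = 0"
    and bilinear: "bilinear_form scale B"
    and linear1: "Vector_Spaces.linear scale scale e1"
    and linear2: "Vector_Spaces.linear scale scale e2"
    and act1: "(i, j) \<in> half_range a \<times> half_range b \<Longrightarrow> e1 (v (i, j)) = scale (s1 (i, j)) (v (i + 1, j))"
    and act2: "(i, j) \<in> half_range a \<times> half_range b \<Longrightarrow> e2 (v (i, j)) = scale (s2 (i, j)) (v (i, j + 1))"
    and s1_nonzero: "(i, j) \<in> half_range a \<times> half_range b \<Longrightarrow> s1 (i, j) \<noteq> 0"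
    and s2_nonzero: "(i, j) \<in> half_range a \<times> half_range b \<Longrightarrow> s2 (i, j) \<noteq> 0"
    and sign_commute: "(i, j) \<in> half_range a \<times> half_range b \<Longrightarrow>
      (i + 1, j + 1) \<in> half_range a \<times> half_range b \<Longrightarrow>
      s2 (i, j) * s1 (i, j + 1) = s1 (i, j) * s2 (i + 1, j)"
    and form: "(i, j) \<in> half_range a \<times> half_range b \<Longrightarrow> (k, l) \<in> half_range a \<times> half_range b \<Longrightarrow>
      B (v (i, j)) (v (- k, - l)) = (if i = k \<and> j = l then t (i, j) else 0)"
    and t_nonzero: "(i, j) \<in> half_range a \<times> half_range b \<Longrightarrow> t (i, j) \<noteq> 0"
    and skew1: "(i, j) \<in> half_range a \<times> half_range b \<Longrightarrow> (i + 1, j) \<in> half_range a \<times> half_range b \<Longrightarrow>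
      s1 (i, j) * t (i + 1, j) = - (s1 (- i - 1, - j) * t (i, j))"
    and skew2: "(i, j) \<in> half_range a \<times> half_range b \<Longrightarrow> (i, j + 1) \<in> half_range a \<times> half_range b \<Longrightarrow>
      s2 (i, j) * t (i, j + 1) = - (s2 (- i, - j - 1) * t (i, j))"
begin

section \<open>Commutation, skewness and cyclicity on a signed rectangle\<close>

abbreviation nodes :: "(rat \<times> rat) set" where
  "nodes \<equiv> half_range a \<times> half_range b"

lemma finite_nodes: "finite nodes"
  using a b by (auto simp: half_natural_def half_range_eq_image elim!: Nats_cases)

lemma uminus_node: "(i, j) \<in> nodes \<Longrightarrow> (- i, - j) \<in> nodes"
  using half_range_uminus[OF a] half_range_uminus[OF b] by auto

lemma v_expansion:
  obtains c where "u = (\<Sum>p\<in>nodes. scale (c p) (v p))"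
  by (rule basis_family_expansion[OF finite_nodes basis UNIV_I])

lemma eq_on_basis:
  assumes "Vector_Spaces.linear scale scale f" "Vector_Spaces.linear scale scale g"
    and "\<And>p. p \<in> nodes \<Longrightarrow> f (v p) = g (v p)"
  shows "f u = g u"
proof -
  obtain c where u: "u = (\<Sum>p\<in>nodes. scale (c p) (v p))"
    by (rule v_expansion)
  show ?thesis
    unfolding u assms(1,2)[THEN linear_sum_scale] using assms(3) by (auto intro!: sum.cong)
qed

lemma bilinear_map_zero_on_basis:
  assumes "bilinear_form scale C" "\<And>p q. p \<in> nodes \<Longrightarrow> q \<in> nodes \<Longrightarrow> C (v p) (v q) = 0"
  shows "C u w = 0"
proof -
  obtain c where u: "u = (\<Sum>p\<in>nodes. scale (c p) (v p))"
    by (rule v_expansion)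
  obtain d where w: "w = (\<Sum>p\<in>nodes. scale (d p) (v p))"
    by (rule v_expansion)
  show ?thesis
    unfolding u w bilinear_form_sum[OF vector_space_axioms assms(1)] by (simp add: assms(2))
qed

lemma linear_map_zero: "Vector_Spaces.linear scale scale f \<Longrightarrow> f 0 = 0"
  using linear_sum_scale[of f "\<lambda>_. 0" "\<lambda>_. 0" "{}"] by simp

lemma linear_map_scale: "Vector_Spaces.linear scale scale f \<Longrightarrow> f (scale c u) = scale c (f u)"
  by (simp add: Vector_Spaces.linear_iff)

text \<open>On a full unit square this is \<open>sign_commute\<close>. If the corner (i + 1, j + 1)
  is missing, its vector is 0 and both sides vanish.\<close>

lemma e1_e2_commute: "e1 (e2 u) = e2 (e1 u)"
proof -
  have "(e1 \<circ> e2) (v (i, j)) = (e2 \<circ> e1) (v (i, j))" if ij: "(i, j) \<in> nodes" for i j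
  proof -
    have "e1 (v (i, j + 1)) =
        (if (i, j + 1) \<in> nodes then scale (s1 (i, j + 1)) (v (i + 1, j + 1)) else 0)"
      using act1 outside by (simp add: linear_map_zero[OF linear1])
    moreover have "e2 (v (i + 1, j)) =
        (if (i + 1, j) \<in> nodes then scale (s2 (i + 1, j)) (v (i + 1, j + 1)) else 0)"
      using act2 outside by (simp add: linear_map_zero[OF linear2])
    ultimately show ?thesis
      using ij sign_commute[of i j] outside[of "(i + 1, j + 1)"]
      by (auto simp: act1 act2 linear_map_scale[OF linear1] linear_map_scale[OF linear2])
  qed
  then have "(e1 \<circ> e2) (v p) = (e2 \<circ> e1) (v p)" if "p \<in> nodes" for p
    using that by (cases p) blast
  then have "(e1 \<circ> e2) u = (e2 \<circ> e1) u"
    by (rule eq_on_basis[OF Vector_Spaces.linear_compose[OF linear2 linear1]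
          Vector_Spaces.linear_compose[OF linear1 linear2]])
  then show ?thesis by simp
qed

text \<open>The actions can push a vector off the rectangle, so one of the two indices may fail to
  be a node. Both may not: for p = q off the rectangle the left side is 0, but \<open>t p\<close> is
  unconstrained.\<close>

lemma form_extended:
  assumes "p \<in> nodes \<or> q \<in> nodes"
  shows "B (v p) (v (- fst q, - snd q)) = (if p = q then t p else 0)"
proof -
  have zero: "B 0 w = 0" "B u 0 = 0" for u w
    using bilinear[unfolded bilinear_form_iff[OF vector_space_axioms]]
    by (metis mult_zero_left scale_zero_left)+
  obtain i j where p: "p = (i, j)" by (cases p)
  obtain k l where q: "q = (k, l)" by (cases q)
  have "v (- k, - l) = 0" if "q \<notin> nodes"
    using that uminus_node[of "- k" "- l"] by (intro outside) (auto simp: q)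
  moreover have "v p = 0" if "p \<notin> nodes"
    using that by (rule outside)
  ultimately show ?thesis
    using assms form[of i j k l] by (cases "p \<in> nodes"; cases "q \<in> nodes") (auto simp: p q zero)
qed

text \<open>Pairing with \<open>v (- q)\<close> isolates the coefficient at q, up to the nonzero
  factor \<open>t q\<close>.\<close>

lemma nondegenerate:
  assumes "\<And>w. B u w = 0"
  shows "u = 0"
proof -
  obtain c where u: "u = (\<Sum>p\<in>nodes. scale (c p) (v p))"
    by (rule v_expansion)
  have "c q = 0" if "q \<in> nodes" for q
  proof -
    have "0 = (\<Sum>p\<in>nodes. c p * B (v p) (v (- fst q, - snd q)))"
      using assms[of "v (- fst q, - snd q)"]
      by (simp add: u bilinear_form_sum[OF vector_space_axioms bilinear])
    also have "\<dots> = (\<Sum>p\<in>nodes. if p = q then c q * t q else 0)"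
      using that by (intro sum.cong) (auto simp: form_extended)
    also have "\<dots> = c q * t q"
      using that finite_nodes by simp
    finally show ?thesis
      using t_nonzero[of "fst q" "snd q"] that by auto
  qed
  then show ?thesis
    by (simp add: u)
qed

lemma B_scale: "B (scale c u) w = c * B u w" "B u (scale c w) = c * B u w"
  and B_add: "B (u + u') w = B u w + B u' w" "B u (w + w') = B u w + B u w'"
  using bilinear by (auto simp: bilinear_form_iff[OF vector_space_axioms])

text \<open>The defect B (e u) w + B u (e w) is itself bilinear, so basis vectors suffice. The
  second one is written \<open>v (- q)\<close> to match \<open>form_extended\<close>.\<close>

lemma skewI:
  assumes "Vector_Spaces.linear scale scale e"
    and "\<And>p q. p \<in> nodes \<Longrightarrow> q \<in> nodes \<Longrightarrow>
      B (e (v p)) (v (- fst q, - snd q)) + B (v p) (e (v (- fst q, - snd q))) = 0"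
  shows "B (e u) w = - B u (e w)"
proof -
  let ?C = "\<lambda>u w. B (e u) w + B u (e w)"
  have "?C u w = 0"
  proof (rule bilinear_map_zero_on_basis[of ?C])
    show "bilinear_form scale ?C"
      using assms(1) unfolding bilinear_form_iff[OF vector_space_axioms] Vector_Spaces.linear_iff
      by (simp add: B_add B_scale distrib_left)
    show "?C (v p) (v q) = 0" if "p \<in> nodes" "q \<in> nodes" for p q
      using assms(2)[of p "(- fst q, - snd q)"] uminus_node[of "fst q" "snd q"] that by simp
  qed
  then show ?thesis
    by (simp add: eq_neg_iff_add_eq_0)
qed

lemma e1_skew: "B (e1 u) w = - B u (e1 w)"
proof (rule skewI[OF linear1])
  fix p q assume "p \<in> nodes" "q \<in> nodes"
  moreover obtain i j k l where pq: "p = (i, j)" "q = (k, l)"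
    by (cases p, cases q)
  ultimately have nodes: "(i, j) \<in> nodes" "(k, l) \<in> nodes" "(- k, - l) \<in> nodes"
    using uminus_node by auto
  show "B (e1 (v p)) (v (- fst q, - snd q)) + B (v p) (e1 (v (- fst q, - snd q))) = 0"
    \<comment> \<open>Since \<open>e1\<close> sends v (-k, -l) to a multiple of v (-(k - 1), -l),
      both terms vanish unless k = i + 1 and l = j; there \<open>skew1\<close> cancels them.\<close>
    using form_extended[of "(i + 1, j)" q] form_extended[of p "(k - 1, l)"] skew1[of i j] nodes
    by (auto simp: pq act1 B_scale)
qed

lemma e2_skew: "B (e2 u) w = - B u (e2 w)"
proof (rule skewI[OF linear2])
  fix p q assume "p \<in> nodes" "q \<in> nodes"
  moreover obtain i j k l where pq: "p = (i, j)" "q = (k, l)"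
    by (cases p, cases q)
  ultimately have nodes: "(i, j) \<in> nodes" "(k, l) \<in> nodes" "(- k, - l) \<in> nodes"
    using uminus_node by auto
  show "B (e2 (v p)) (v (- fst q, - snd q)) + B (v p) (e2 (v (- fst q, - snd q))) = 0"
    using form_extended[of "(i, j + 1)" q] form_extended[of p "(k, l - 1)"] skew2[of i j] nodes
    by (auto simp: pq act2 B_scale)
qed

text \<open>The monomial walks l steps up and then k steps right. The bounds keep every step inside
  the rectangle, so the factor is a product of nonzero coefficients.\<close>

lemma monomial_source:
  assumes "2 * a = of_nat m" "2 * b = of_nat n" "k \<le> m" "l \<le> n"
  shows "\<exists>c. c \<noteq> 0 \<and>
    pair_monomial e1 e2 (k, l) (v (- a, - b)) = scale c (v (- a + of_nat k, - b + of_nat l))"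
  using \<open>k \<le> m\<close>
proof (induction k)
  case 0
  show ?case
    using \<open>l \<le> n\<close>
  proof (induction l)
    case 0
    show ?case
      by (auto simp: pair_monomial_def intro: exI[of _ 1])
  next
    case (Suc l)
    then obtain c where c: "c \<noteq> 0" "(e2 ^^ l) (v (- a, - b)) = scale c (v (- a, - b + of_nat l))"
      by (auto simp: pair_monomial_def)
    have node: "(- a, - b + of_nat l) \<in> nodes"
      using Suc.prems by (auto simp: half_range_eq_image[OF assms(1)] half_range_eq_image[OF assms(2)]
          intro: image_eqI[of _ _ 0])
    have "(e2 ^^ Suc l) (v (- a, - b)) =
        scale (c * s2 (- a, - b + of_nat l)) (v (- a, - b + of_nat (Suc l)))"
      by (simp only: funpow.simps o_apply c(2) linear_map_scale[OF linear2] act2[OF node] scale_scale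
          of_nat_Suc add.assoc add.commute[of 1])
    then show ?case
      using c(1) s2_nonzero[OF node]
      by (intro exI[of _ "c * s2 (- a, - b + of_nat l)"]) (simp add: pair_monomial_def)
  qed
next
  case (Suc k)
  let ?w = "(e2 ^^ l) (v (- a, - b))"
  obtain c where c: "c \<noteq> 0" "(e1 ^^ k) ?w = scale c (v (- a + of_nat k, - b + of_nat l))"
    using Suc by (auto simp: pair_monomial_def)
  have node: "(- a + of_nat k, - b + of_nat l) \<in> nodes"
    using Suc.prems \<open>l \<le> n\<close>
    by (auto simp: half_range_eq_image[OF assms(1)] half_range_eq_image[OF assms(2)])
  have "(e1 ^^ Suc k) ?w =
      scale (c * s1 (- a + of_nat k, - b + of_nat l)) (v (- a + of_nat (Suc k), - b + of_nat l))"
    by (simp only: funpow.simps o_apply c(2) linear_map_scale[OF linear1] act1[OF node] scale_scale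
        of_nat_Suc add.assoc add.commute[of 1])
  then show ?case
    using c(1) s1_nonzero[OF node]
    by (intro exI[of _ "c * s1 (- a + of_nat k, - b + of_nat l)"]) (simp add: pair_monomial_def)
qed

text \<open>Up to nonzero scalars \<open>d\<close> and the bijection \<open>g\<close> from exponents
  to nodes, this family is the given basis \<open>v\<close>.\<close>

lemma cyclic_basis:
  "finite {(k, l). (- a + of_nat k, - b + of_nat l) \<in> nodes}"
  "basis_family scale (\<lambda>p. pair_monomial e1 e2 p (v (- a, - b)))
    {(k, l). (- a + of_nat k, - b + of_nat l) \<in> nodes} UNIV"
proof -
  obtain m n where m: "2 * a = of_nat m" and n: "2 * b = of_nat n"
    using a b by (auto simp: half_natural_def elim!: Nats_cases)
  note H = half_range_eq_image[OF m] half_range_eq_image[OF n]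
  define N :: "(nat \<times> nat) set" where "N = {..m} \<times> {..n}"
  have N: "{(k, l). (- a + of_nat k, - b + of_nat l) \<in> nodes} = N"
    by (auto simp: H N_def)
  have fin: "finite N"
    by (simp add: N_def)
  then show "finite {(k, l). (- a + of_nat k, - b + of_nat l) \<in> nodes}"
    unfolding N .
  define g :: "nat \<times> nat \<Rightarrow> rat \<times> rat" where "g = (\<lambda>(k, l). (- a + of_nat k, - b + of_nat l))"
  have bij: "bij_betw g N nodes"
    by (auto simp: bij_betw_def inj_on_def g_def N_def H image_iff)
  have "\<forall>p\<in>N. \<exists>c. c \<noteq> 0 \<and> pair_monomial e1 e2 p (v (- a, - b)) = scale c (v (g p))"
    using monomial_source[OF m n] unfolding N_def g_def by fast
  then obtain d where d: "\<And>p. p \<in> N \<Longrightarrow> d p \<noteq> 0"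
    "\<And>p. p \<in> N \<Longrightarrow> pair_monomial e1 e2 p (v (- a, - b)) = scale (d p) (v (g p))"
    by metis
  have comb: "(\<Sum>p\<in>N. scale (c p) (pair_monomial e1 e2 p (v (- a, - b)))) =
      (\<Sum>q\<in>nodes. scale ((\<lambda>p. c p * d p) (inv_into N g q)) (v q))" for c
  proof -
    have "(\<Sum>q\<in>nodes. scale ((\<lambda>p. c p * d p) (inv_into N g q)) (v q)) =
        (\<Sum>p\<in>N. scale ((\<lambda>p. c p * d p) (inv_into N g (g p))) (v (g p)))"
      by (rule sum.reindex_bij_betw[OF bij, symmetric])
    also have "\<dots> = (\<Sum>p\<in>N. scale (c p) (pair_monomial e1 e2 p (v (- a, - b))))"
      by (intro sum.cong) (simp_all add: d(2) bij_betw_inv_into_left[OF bij])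
    finally show ?thesis by simp
  qed
  have indep: "c p = 0"
    if "(\<Sum>p\<in>N. scale (c p) (pair_monomial e1 e2 p (v (- a, - b)))) = 0" "p \<in> N" for c p
  proof -
    have "(\<lambda>p. c p * d p) (inv_into N g (g p)) = 0"
      using that bij_betwE[OF bij] unfolding comb
      by (intro basis_family_coeff_zero[OF finite_nodes basis,
            of "\<lambda>q. (\<lambda>p. c p * d p) (inv_into N g q)"]) auto
    then show ?thesis
      using that(2) d(1) by (simp add: bij_betw_inv_into_left[OF bij])
  qed
  have span: "u \<in> range (\<lambda>c. \<Sum>p\<in>N. scale (c p) (pair_monomial e1 e2 p (v (- a, - b))))" for u
  proof -
    obtain c where u: "u = (\<Sum>p\<in>nodes. scale (c p) (v p))"
      by (rule v_expansion)
    \<comment> \<open>Dividing by \<open>d p\<close> undoes the rescaling.\<close>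
    have "u = (\<Sum>p\<in>N. scale (c (g p) / d p) (pair_monomial e1 e2 p (v (- a, - b))))"
      unfolding comb u
    proof (intro sum.cong refl)
      fix q assume "q \<in> nodes"
      then have "d (inv_into N g q) \<noteq> 0" "g (inv_into N g q) = q"
        using d(1) bij_betw_inv_into_right[OF bij] bij_betwE[OF bij_betw_inv_into[OF bij]] by blast+
      then show "scale (c q) (v q) = scale ((\<lambda>p. c (g p) / d p * d p) (inv_into N g q)) (v q)"
        by simp
    qed
    then show ?thesis
      by (intro image_eqI[where x = "\<lambda>p. c (g p) / d p"] UNIV_I)
  qed
  show "basis_family scale (\<lambda>p. pair_monomial e1 e2 p (v (- a, - b)))
      {(k, l). (- a + of_nat k, - b + of_nat l) \<in> nodes} UNIV"
    unfolding N basis_family_finite_iff[OF fin] using indep span by blast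
qed

lemma basis_centralizer:
  assumes "(2 :: 'k) \<noteq> 0"
  shows "basis_family (end_scale scale) (pair_monomial e1 e2)
    {(k, l). (- a + of_nat k, - b + of_nat l) \<in> nodes \<and> odd (k + l)}
    (lie_centralizer (so_alg scale B) {e1, e2})"
proof -
  have "\<forall>u. (\<forall>w. B u w = 0) \<longrightarrow> u = 0"
    by (rule allI, rule impI, rule nondegenerate, erule spec)
  from basis_centralizer_cyclic[where ?e1.0 = e1 and ?e2.0 = e2 and B = B,
      OF cyclic_basis linear1 linear2 e1_e2_commute bilinear e1_skew e2_skew this assms]
  show ?thesis
    by (simp only: mem_Collect_eq prod.case)
qed

end

section \<open>The signs of the construction\<close>

text \<open>Turns sign identities into statements about the parity of floors.\<close>

lemma minus_one_powi: "(- 1 :: 'k::field) powi z = (if even z then 1 else - 1)"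
  by (auto simp: power_int_def minus_one_power_iff even_nat_iff)

lemma half_range_Ints: "a \<in> \<int> \<Longrightarrow> i \<in> half_range a \<Longrightarrow> i \<in> \<int>"
  by (auto simp: half_range_def)

lemma half_range_half_odd:
  assumes "half_odd a" "i \<in> half_range a"
  shows "half_odd i"
proof -
  obtain z where z: "a - 1 / 2 = of_int z"
    using assms(1) by (auto simp: half_odd_def elim: Ints_cases)
  obtain k where "i = - a + of_nat k"
    using assms(2) by (auto simp: half_range_def)
  then have "i - 1 / 2 = of_int (int k - z - 1)"
    using z by simp
  then show ?thesis
    unfolding half_odd_def by (metis Ints_of_int)
qed

text \<open>These cases decide the signs of both j and j + 1; they differ only in the middle one,
  the step across 0.\<close>

lemma half_odd_cases:
  assumes "half_odd j"
  shows "j \<ge> 1 / 2 \<or> j = - 1 / 2 \<or> j \<le> - 3 / 2"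
proof -
  obtain z where z: "j - 1 / 2 = of_int z"
    using assms by (auto simp: half_odd_def elim: Ints_cases)
  consider "z \<ge> 0" | "z = - 1" | "z \<le> - 2"
    by linarith
  then show ?thesis
  proof cases
    case 1
    then have "(0 :: rat) \<le> of_int z" by simp
    with z show ?thesis by linarith
  next
    case 2
    with z show ?thesis by simp
  next
    case 3
    then have "(of_int z :: rat) \<le> of_int (- 2)"
      by (simp only: of_int_le_iff)
    with z show ?thesis by simp
  qed
qed

lemma half_natural_cases:
  assumes "half_natural a"
  shows "a \<in> \<int> \<or> half_odd a"
proof -
  obtain m where m: "2 * a = of_nat m"
    using assms by (auto simp: half_natural_def elim: Nats_cases)
  show ?thesis
  proof (cases "even m")
    case True
    then obtain k where "m = 2 * k" by (elim evenE)
    with m have "a = of_nat k" by simp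
    then show ?thesis by simp
  next
    case False
    then obtain k where "m = 2 * k + 1" by (elim oddE)
    with m have "a - 1 / 2 = of_nat k" by simp
    then show ?thesis by (simp add: half_odd_def)
  qed
qed

text \<open>Polarization: expand B (u + w) (u + w) = 0.\<close>

lemma alternating_form_swap:
  assumes "vector_space s" "bilinear_form s B" "alternating_form B"
  shows "B u w = - B w u"
proof -
  have "B (u + w) (u + w) = B u u + B u w + (B w u + B w w)"
    using assms(2) by (simp add: bilinear_form_iff[OF assms(1)])
  then show ?thesis
    using assms(3) by (simp add: alternating_form_def eq_neg_iff_add_eq_0)
qed

text \<open>In the semi-integral case this is the value of the form on \<open>v p\<close> and
  \<open>v (- p)\<close>, where j is the half-odd coordinate of p; its negative is the coefficient
  of the arrows that keep j.\<close>

definition half_sign :: "rat \<Rightarrow> 'k::field" where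
  "half_sign j = (if j > 0 then 1 else - 1)"

text \<open>Coefficient of the arrows that raise the half-odd coordinate j; i is the integer
  one.\<close>

definition crossing_sign :: "rat \<Rightarrow> rat \<Rightarrow> 'k::field" where
  "crossing_sign i j = (if j > 0 then 1 else if j = - 1 / 2 then (- 1) powi \<lfloor>i\<rfloor> else - 1)"

lemma sign_nonzero [simp]: "half_sign j \<noteq> 0" "crossing_sign i j \<noteq> 0"
  by (auto simp: half_sign_def crossing_sign_def minus_one_powi)

lemma half_sign_uminus:
  assumes "half_odd j"
  shows "half_sign (- j) = - half_sign j"
  using half_odd_cases[OF assms] by (auto simp: half_sign_def)

text \<open>The square condition. At j = -1/2 \<open>half_sign\<close> flips from j to j + 1, and
  the alternation of (-1)^i compensates; elsewhere both signs are constant.\<close>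

lemma crossing_sign_half_sign:
  assumes "half_odd j"
  shows "crossing_sign i j * half_sign (j + 1) = (half_sign j * crossing_sign (i + 1) j :: 'k::field)"
proof -
  have "even \<lfloor>i + 1\<rfloor> \<longleftrightarrow> odd \<lfloor>i\<rfloor>"
    by simp
  with half_odd_cases[OF assms] show ?thesis
    by (auto simp: half_sign_def crossing_sign_def minus_one_powi)
qed

text \<open>The skewness condition: the arrow from (i, j) to (i, j + 1) reflects to the one starting
  at (-i, -j - 1). Reflection swaps the outer cases and fixes j = -1/2, where i and -i have equal
  parity.\<close>

lemma crossing_sign_adjoint:
  assumes "i \<in> \<int>" "half_odd j"
  shows "crossing_sign (- i) (- j - 1) * half_sign j =
    (- (crossing_sign i j * half_sign (j + 1)) :: 'k::field)"
proof -
  have "even \<lfloor>- i\<rfloor> \<longleftrightarrow> even \<lfloor>i\<rfloor>"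
    using assms(1) by (auto elim!: Ints_cases simp flip: of_int_minus)
  with half_odd_cases[OF assms(2)] show ?thesis
    by (auto simp: half_sign_def crossing_sign_def minus_one_powi)
qed

section \<open>Verification of the three sign conventions\<close>

context skew_graph_pair
begin

lemma pverts_eq: "pverts (rect_skew_graph a b) = half_range a \<times> half_range b"
  by (simp add: rect_skew_graph_def)

lemmas basis_and_linearity = v_basis[unfolded pverts_eq] v_outside[unfolded pverts_eq] bilinear_B
  linear_e1 linear_e2

text \<open>Put n = i + j. Around a square both products of signs are 1. Reflecting an arrow changes
  the parity of its exponent, which is the minus sign of skewness when \<open>t\<close> is
  1.\<close>

lemma signed_rectangle_integral:
  assumes ab: "half_natural a" "half_natural b"
    and type: "integral_graph a b \<or> non_integral_graph a b"
  shows "signed_rectangle scale a b v B e1 e2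
    (\<lambda>(i, j). (- 1) powi \<lfloor>i + j\<rfloor>) (\<lambda>(i, j). (- 1) powi \<lfloor>i + j + 1\<rfloor>) (\<lambda>_. 1)"
proof -
  \<comment> \<open>Even for half-odd i and j the sum is an integer; otherwise negation would not
    commute with the floor.\<close>
  have sum_int: "i + j \<in> \<int>" if "i \<in> half_range a" "j \<in> half_range b" for i j
  proof (cases "integral_graph a b")
    case True
    then show ?thesis
      using half_range_Ints[OF _ that(1)] half_range_Ints[OF _ that(2)]
      by (simp add: integral_graph_def)
  next
    case False
    then have "i - 1 / 2 \<in> \<int>" "j - 1 / 2 \<in> \<int>"
      using type half_range_half_odd[OF _ that(1)] half_range_half_odd[OF _ that(2)]
      by (auto simp: non_integral_graph_def half_odd_def)
    then have "(i - 1 / 2) + (j - 1 / 2) + 1 \<in> \<int>"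
      by (intro Ints_add Ints_1)
    then show ?thesis by simp
  qed
  have sign: "even \<lfloor>i + 1 + j\<rfloor> \<longleftrightarrow> odd \<lfloor>i + j\<rfloor>" "even \<lfloor>i + j + 1\<rfloor> \<longleftrightarrow> odd \<lfloor>i + j\<rfloor>"
    "even \<lfloor>i + (j + 1)\<rfloor> \<longleftrightarrow> odd \<lfloor>i + j\<rfloor>" "even \<lfloor>i + 1 + j + 1\<rfloor> \<longleftrightarrow> even \<lfloor>i + j\<rfloor>"
    "even \<lfloor>- i - 1 - j\<rfloor> \<longleftrightarrow> odd \<lfloor>i + j\<rfloor>" "even \<lfloor>- j - 1 - i\<rfloor> \<longleftrightarrow> odd \<lfloor>i + j\<rfloor>"
      "even \<lfloor>- i - j\<rfloor> \<longleftrightarrow> even \<lfloor>i + j\<rfloor>"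
    if ij: "i \<in> half_range a" "j \<in> half_range b" for i j
  proof -
    obtain z where "i + j = of_int z"
      using sum_int[OF ij] by (elim Ints_cases)
    then have "\<lfloor>i + j\<rfloor> = z" "\<lfloor>i + 1 + j\<rfloor> = z + 1" "\<lfloor>i + j + 1\<rfloor> = z + 1" "\<lfloor>i + (j + 1)\<rfloor> = z + 1"
      "\<lfloor>i + 1 + j + 1\<rfloor> = z + 2" "\<lfloor>- i - 1 - j\<rfloor> = - z - 1" "\<lfloor>- j - 1 - i\<rfloor> = - z - 1"
      "\<lfloor>- i - j\<rfloor> = - z"
      by (auto simp: floor_eq_iff)
    then show "even \<lfloor>i + 1 + j\<rfloor> \<longleftrightarrow> odd \<lfloor>i + j\<rfloor>" "even \<lfloor>i + j + 1\<rfloor> \<longleftrightarrow> odd \<lfloor>i + j\<rfloor>"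
      "even \<lfloor>i + (j + 1)\<rfloor> \<longleftrightarrow> odd \<lfloor>i + j\<rfloor>" "even \<lfloor>i + 1 + j + 1\<rfloor> \<longleftrightarrow> even \<lfloor>i + j\<rfloor>"
      "even \<lfloor>- i - 1 - j\<rfloor> \<longleftrightarrow> odd \<lfloor>i + j\<rfloor>" "even \<lfloor>- j - 1 - i\<rfloor> \<longleftrightarrow> odd \<lfloor>i + j\<rfloor>"
      "even \<lfloor>- i - j\<rfloor> \<longleftrightarrow> even \<lfloor>i + j\<rfloor>"
      by simp_all
  qed
  note form = integral_or_non_integral_form[OF type, unfolded pverts_eq, THEN conjunct2]
  note act = integral_or_non_integral_action[OF type, unfolded pverts_eq]
  show ?thesis
  proof (intro signed_rectangle.intro signed_rectangle_axioms.intro vector_space_axioms)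
    fix i j k l assume "(i, j) \<in> half_range a \<times> half_range b" "(k, l) \<in> half_range a \<times> half_range b"
    then show "B (v (i, j)) (v (- k, - l)) = (if i = k \<and> j = l then 1 else 0)"
      using form by blast
  next
    fix i j assume ij: "(i, j) \<in> half_range a \<times> half_range b"
    show "e1 (v (i, j)) = scale ((\<lambda>(i, j). (- 1) powi \<lfloor>i + j\<rfloor>) (i, j)) (v (i + 1, j))"
      and "e2 (v (i, j)) = scale ((\<lambda>(i, j). (- 1) powi \<lfloor>i + j + 1\<rfloor>) (i, j)) (v (i, j + 1))"
      using act ij by auto
  qed (use ab basis_and_linearity in \<open>auto simp: minus_one_powi sign\<close>)
qed

lemma signed_rectangle_semi_integral_1:
  assumes ab: "half_natural a" "half_natural b"
    and type: "semi_integral_graph a b \<and> a \<in> \<int> \<and> half_odd b"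
  shows "signed_rectangle scale a b v B e1 e2
    (\<lambda>(i, j). - half_sign j) (\<lambda>(i, j). crossing_sign i j) (\<lambda>(i, j). half_sign j)"
proof -
  have ints: "i \<in> \<int>" if "i \<in> half_range a" for i
    using half_range_Ints that type by blast
  have odd: "half_odd j" if "j \<in> half_range b" for j
    using half_range_half_odd that type by blast
  note form = semi_integral_form_1[OF type, unfolded pverts_eq]
  note act = semi_integral_action_1[OF type, unfolded pverts_eq]
  note swap = alternating_form_swap[OF vector_space_axioms bilinear_B form[THEN conjunct1]]
  show ?thesis
  proof (intro signed_rectangle.intro signed_rectangle_axioms.intro vector_space_axioms)
    fix i j k l
    assume ij: "(i, j) \<in> half_range a \<times> half_range b" and kl: "(k, l) \<in> half_range a \<times> half_range b"
    have neg: "(- i, - j) \<in> half_range a \<times> half_range b"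
      using ij half_range_uminus ab by auto
    \<comment> \<open>The construction prescribes the form for j > 0 only; antisymmetry gives the
      other half.\<close>
    have "B (v (i, j)) (v (- i, - j)) = - 1" if "\<not> j > 0"
    proof -
      have "- j > 0"
        using that half_odd_cases[OF odd[of j]] ij by auto
      then have "B (v (- i, - j)) (v (i, j)) = 1"
        using form neg by force
      then show ?thesis
        by (simp add: swap[of "v (i, j)"])
    qed
    then show "B (v (i, j)) (v (- k, - l)) =
        (if i = k \<and> j = l then (\<lambda>(i, j). half_sign j) (i, j) else 0)"
      using form ij kl by (auto simp: half_sign_def)
  next
    fix i j assume ij: "(i, j) \<in> half_range a \<times> half_range b"
    then have "j \<ge> 1 / 2 \<or> j = - 1 / 2 \<or> j \<le> - 3 / 2"
      using half_odd_cases odd by blast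
    then show "e1 (v (i, j)) = scale ((\<lambda>(i, j). - half_sign j) (i, j)) (v (i + 1, j))"
      and "e2 (v (i, j)) = scale ((\<lambda>(i, j). crossing_sign i j) (i, j)) (v (i, j + 1))"
      using act ij by (auto simp: half_sign_def crossing_sign_def)
  qed (use ab basis_and_linearity in \<open>auto simp: half_sign_uminus crossing_sign_half_sign
    crossing_sign_adjoint ints odd\<close>)
qed

text \<open>The transpose of the preceding case; \<open>crossing_sign\<close> takes the integer
  coordinate, now j, first.\<close>

lemma signed_rectangle_semi_integral_2:
  assumes ab: "half_natural a" "half_natural b"
    and type: "semi_integral_graph a b \<and> b \<in> \<int> \<and> half_odd a"
  shows "signed_rectangle scale a b v B e1 e2
    (\<lambda>(i, j). crossing_sign j i) (\<lambda>(i, j). - half_sign i) (\<lambda>(i, j). half_sign i)"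
proof -
  have ints: "j \<in> \<int>" if "j \<in> half_range b" for j
    using half_range_Ints that type by blast
  have odd: "half_odd i" if "i \<in> half_range a" for i
    using half_range_half_odd that type by blast
  note form = semi_integral_form_2[OF type, unfolded pverts_eq]
  note act = semi_integral_action_2[OF type, unfolded pverts_eq]
  note swap = alternating_form_swap[OF vector_space_axioms bilinear_B form[THEN conjunct1]]
  show ?thesis
  proof (intro signed_rectangle.intro signed_rectangle_axioms.intro vector_space_axioms)
    fix i j k l
    assume ij: "(i, j) \<in> half_range a \<times> half_range b" and kl: "(k, l) \<in> half_range a \<times> half_range b"
    have neg: "(- i, - j) \<in> half_range a \<times> half_range b"
      using ij half_range_uminus ab by auto
    have "B (v (i, j)) (v (- i, - j)) = - 1" if "\<not> i > 0"
    proof -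
      have "- i > 0"
        using that half_odd_cases[OF odd[of i]] ij by auto
      then have "B (v (- i, - j)) (v (i, j)) = 1"
        using form neg by force
      then show ?thesis
        by (simp add: swap[of "v (i, j)"])
    qed
    then show "B (v (i, j)) (v (- k, - l)) =
        (if i = k \<and> j = l then (\<lambda>(i, j). half_sign i) (i, j) else 0)"
      using form ij kl by (auto simp: half_sign_def)
  next
    fix i j assume ij: "(i, j) \<in> half_range a \<times> half_range b"
    then have "i \<ge> 1 / 2 \<or> i = - 1 / 2 \<or> i \<le> - 3 / 2"
      using half_odd_cases odd by blast
    then show "e1 (v (i, j)) = scale ((\<lambda>(i, j). crossing_sign j i) (i, j)) (v (i + 1, j))"
      and "e2 (v (i, j)) = scale ((\<lambda>(i, j). - half_sign i) (i, j)) (v (i, j + 1))"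
      using act ij by (auto simp: half_sign_def crossing_sign_def)
  qed (use ab basis_and_linearity in \<open>auto simp: half_sign_uminus crossing_sign_half_sign
    crossing_sign_adjoint ints odd\<close>)
qed

text \<open>Each of a and b is an integer or half-odd, and the four combinations fall under the
  three conventions. The type is returned as well because it determines the Lie algebra.\<close>

lemma signed_rectangle_exists:
  assumes "half_natural a" "half_natural b"
  obtains s1 s2 t where "signed_rectangle scale a b v B e1 e2 s1 s2 t"
    and "integral_graph a b \<or> non_integral_graph a b \<or> semi_integral_graph a b"
proof -
  have odd_sum: "half_odd (x + y)" if "x \<in> \<int>" "half_odd y" for x y
    using Ints_add[OF that(1) that(2)[unfolded half_odd_def]] by (simp add: half_odd_def algebra_simps)
  consider "integral_graph a b \<or> non_integral_graph a b"
    | "semi_integral_graph a b \<and> a \<in> \<int> \<and> half_odd b"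
    | "semi_integral_graph a b \<and> b \<in> \<int> \<and> half_odd a"
    using half_natural_cases[OF assms(1)] half_natural_cases[OF assms(2)]
      odd_sum[of a b] odd_sum[of b a]
    by (auto simp: integral_graph_def non_integral_graph_def semi_integral_graph_def add.commute)
  then show ?thesis
    using that signed_rectangle_integral signed_rectangle_semi_integral_1
      signed_rectangle_semi_integral_2 assms by cases blast+
qed

end

text \<open>Carries the result for \<open>so_alg\<close> over to the semi-integral case, where
  \<open>B\<close> is alternating.\<close>

lemma so_alg_eq_sp_alg: "so_alg = sp_alg"
  by (simp add: so_alg_def sp_alg_def fun_eq_iff)

theorem mainTheorem4:
  fixes scale :: "'k::{alg_closed_field, field_char_0} \<Rightarrow> 'v::ab_group_add \<Rightarrow> 'v"
    and a b i0 j0 :: rat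
    and \<Gamma> :: "(rat \<times> rat) pair_pre_digraph"
    and v :: "rat \<times> rat \<Rightarrow> 'v"
    and B :: "'v \<Rightarrow> 'v \<Rightarrow> 'k"
    and e1 e2 :: "'v \<Rightarrow> 'v"
    and \<gg> :: "('v \<Rightarrow> 'v) set"
  assumes "half_natural a" and "half_natural b"
    and "\<Gamma> = rect_skew_graph a b"
    and "Digraph_Component.connected \<Gamma>"
    and "is_source \<Gamma> (i0, j0)"
    and "skew_graph_pair scale a b v B e1 e2"
    and "integral_graph a b \<or> non_integral_graph a b \<Longrightarrow> \<gg> = so_alg scale B"
    and "semi_integral_graph a b \<Longrightarrow> \<gg> = sp_alg scale B"
  shows "basis_family (end_scale scale) (\<lambda>(k, l). (e1 ^^ k) \<circ> (e2 ^^ l))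
           {(k, l). (i0 + of_nat k, j0 + of_nat l) \<in> pverts \<Gamma> \<and> odd (k + l)}
           (lie_centralizer \<gg> {e1, e2}) \<and>
         lie_centralizer \<gg> {e1, e2} =
           module.span (end_scale scale)
             {(e1 ^^ k) \<circ> (e2 ^^ l) | k l.
                (i0 + of_nat k, j0 + of_nat l) \<in> pverts \<Gamma> \<and> odd (k + l)}"
proof -
  interpret skew_graph_pair scale a b v B e1 e2 by fact
  obtain s1 s2 t where rect: "signed_rectangle scale a b v B e1 e2 s1 s2 t"
    and type: "integral_graph a b \<or> non_integral_graph a b \<or> semi_integral_graph a b"
    using assms(1,2) by (rule signed_rectangle_exists)
  have \<gg>: "\<gg> = so_alg scale B"
    using type assms(7,8) by (auto simp: so_alg_eq_sp_alg)
  have source: "i0 = - a" "j0 = - b"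
    using source_rect_skew_graph[OF assms(1,2)] assms(3,5) by blast+
  let ?N = "{(k, l). (i0 + of_nat k, j0 + of_nat l) \<in> pverts \<Gamma> \<and> odd (k + l)}"
  have basis: "basis_family (end_scale scale) (\<lambda>(k, l). (e1 ^^ k) \<circ> (e2 ^^ l)) ?N
      (lie_centralizer \<gg> {e1, e2})"
    using signed_rectangle.basis_centralizer[OF rect]
    unfolding \<gg> source assms(3) pverts_eq pair_monomial_def by simp
  \<comment> \<open>The span claim is the last clause of \<open>basis_family\<close>, once the image
    is written as a set comprehension.\<close>
  have "(\<lambda>(k, l). (e1 ^^ k) \<circ> (e2 ^^ l)) ` ?N =
      {(e1 ^^ k) \<circ> (e2 ^^ l) | k l. (i0 + of_nat k, j0 + of_nat l) \<in> pverts \<Gamma> \<and> odd (k + l)}"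
    by auto
  with basis show ?thesis
    unfolding basis_family_def by auto
qed

end
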